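(* Suppose there is a norm $\|\gamma\|$, a linear set $\Gamma$ (of functions $\gamma$, containing $\gamma_0$, on which $\|\cdot\|$ is defined), and a set $\mathcal H$ of distributions such that for all $H\in\mathcal H$, with $F_\tau=(1-\tau)F_0+\tau H$: i) $\alpha(F_\tau)=\alpha_0$ (for all small $\tau\geq 0$) and $\frac{d}{d\tau}\bar\psi(\gamma(F_\tau),\alpha(F_\tau),\theta_0)=0$; ii) $\gamma\mapsto\bar\psi(\gamma,\alpha_0,\theta_0)$ is Hadamard differentiable at $\gamma_0$ tangentially to $\Gamma$, with derivative $\bar\psi_\gamma(\delta,\alpha_0,\theta_0)$, $\delta\in\Gamma$; iii) $\tau\mapsto\gamma(F_\tau)$ is Hadamard differentiable at $\tau=0$; iv) the closure of $\{d\gamma(F_\tau)/d\tau: H\in\mathcal H\}$ is $\Gamma$. Then $$\bar\psi_\gamma(\delta,\alpha_0,\theta_0)=0\quad\text{for all }\delta\in\Gamma.$$ Furthermore, if $\gamma\mapsto\bar\psi(\gamma,\alpha_0,\theta_0)$ is twice continuously Fr\'echet differentiable in a neighborhood of $\gamma_0$, then there is $C>0$ such that for all $\gamma\in\Gamma$ with $\|\gamma-\gamma_0\|$ small enough $$\|\bar\psi(\gamma,\alpha_0,\theta_0)\|\le C\|\gamma-\gamma_0\|^2 .$$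
   Context: $W$ has true distribution $F_0$, and $E[\cdot]$ is expectation under $F_0$. $g(w,\gamma,\theta)$ is a vector of identifying moment functions with $E[g(W,\gamma_0,\theta_0)]=0$; $\phi(w,\gamma,\alpha,\theta)$ is a vector of functions of the same dimension (the nonparametric influence function) with $E[\phi(W,\gamma_0,\alpha_0,\theta_0)]=0$. $F\mapsto\gamma(F)$, $F\mapsto\alpha(F)$ are maps from distributions to functions, $\gamma_0=\gamma(F_0)$, $\alpha_0=\alpha(F_0)$. $\psi=g+\phi$ and $\bar\psi(\gamma,\alpha,\theta)=E[\psi(W,\gamma,\alpha,\theta)]$, a finite dimensional vector. All functions $\gamma$ and $\gamma(F_\tau)$ under consideration belong to the normed linear space $(\Gamma,\|\cdot\|)$. $d/d\tau$ is the derivative from the right at $\tau=0$ (in norm, for $\gamma(F_\tau)$). Hadamard derivatives tangential to a set are as usual: continuous linear maps $\delta\mapsto\bar\psi_\gamma(\delta,\alpha_0,\theta_0)$ such that $[\bar\psi(\gamma_0+t\delta_t,\alpha_0,\theta_0)-\bar\psi(\gamma_0,\alpha_0,\theta_0)]/t\to\bar\psi_\gamma(\delta,\alpha_0,\theta_0)$ whenever $t\downarrow0$, $\delta_t\to\delta\in\Gamma$. *)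

theory Defs
  imports "HOL-Probability.Probability"
begin

text \<open>Conventions. A distribution of \<open>W\<close> is an element of
  \<open>space (prob_algebra M)\<close>, i.e. a probability measure on the measurable space \<open>M\<close>.
  The normed linear space \<open>(\<Gamma>, \<parallel>\<cdot>\<parallel>)\<close> of functions is rendered as an arbitrary type
  \<open>'g :: real_normed_vector\<close>; thus \<open>\<gamma> \<in> \<Gamma>\<close> is \<open>\<gamma> :: 'g\<close>, and \<open>\<Gamma>\<close>
  as a set is \<open>UNIV :: 'g set\<close>. No completeness is assumed.\<close>

text \<open>\<open>(1 - \<tau>) F + \<tau> H\<close>, for measures with the same measurable sets. It is meaningful only for
  \<open>0 \<le> \<tau> \<le> 1\<close>, as \<open>ennreal\<close> truncates negative numbers to \<open>0\<close>.\<close>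

definition mixture :: "real \<Rightarrow> 'w measure \<Rightarrow> 'w measure \<Rightarrow> 'w measure" where
  "mixture \<tau> F H = measure_of (space F) (sets F)
     (\<lambda>A. ennreal (1 - \<tau>) * emeasure F A + ennreal \<tau> * emeasure H A)"

lemma space_mixture [simp]: "space (mixture \<tau> F H) = space F"
  and sets_mixture [simp]: "sets (mixture \<tau> F H) = sets F"
  by (simp_all add: mixture_def)

lemma emeasure_mixture:
  assumes "sets H = sets F" and "A \<in> sets F"
  shows "emeasure (mixture \<tau> F H) A = ennreal (1 - \<tau>) * emeasure F A + ennreal \<tau> * emeasure H A"
proof (rule emeasure_measure_of[OF mixture_def])
  show "countably_additive (sets (mixture \<tau> F H))
    (\<lambda>A. ennreal (1 - \<tau>) * emeasure F A + ennreal \<tau> * emeasure H A)"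
  proof (rule countably_additiveI)
    fix B :: "nat \<Rightarrow> 'a set"
    assume B: "range B \<subseteq> sets (mixture \<tau> F H)" "disjoint_family B"
    then have "(\<Sum>i. emeasure F (B i)) = emeasure F (\<Union>i. B i)"
      and "(\<Sum>i. emeasure H (B i)) = emeasure H (\<Union>i. B i)"
      using assms by (auto intro!: suminf_emeasure)
    then show "(\<Sum>i. ennreal (1 - \<tau>) * emeasure F (B i) + ennreal \<tau> * emeasure H (B i))
      = ennreal (1 - \<tau>) * emeasure F (\<Union>i. B i) + ennreal \<tau> * emeasure H (\<Union>i. B i)"
      by (simp add: suminf_add[symmetric] ennreal_suminf_cmult)
  qed
qed (use assms sets.sets_into_space in \<open>auto simp: positive_def\<close>)

lemma mixture_0: "sets H = sets F \<Longrightarrow> mixture 0 F H = F"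
  by (rule measure_eqI) (simp_all add: emeasure_mixture)

lemma mixture_in_prob_algebra:
  assumes "F \<in> space (prob_algebra M)" "H \<in> space (prob_algebra M)" "0 \<le> \<tau>" "\<tau> \<le> 1"
  shows "mixture \<tau> F H \<in> space (prob_algebra M)"
proof -
  have sets: "sets F = sets M" "sets H = sets M" and prob: "prob_space F" "prob_space H"
    using assms by (auto simp: space_prob_algebra)
  have "emeasure F (space F) = 1" "emeasure H (space F) = 1"
    using sets prob[THEN prob_space.emeasure_space_1] sets_eq_imp_space_eq[of H F] by simp_all
  moreover have "emeasure (mixture \<tau> F H) (space F)
      = ennreal (1 - \<tau>) * emeasure F (space F) + ennreal \<tau> * emeasure H (space F)"
    by (intro emeasure_mixture sets.top) (simp only: sets)
  ultimately have "emeasure (mixture \<tau> F H) (space F) = ennreal (1 - \<tau>) + ennreal \<tau>"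
    by simp
  also have "\<dots> = 1"
    using assms by (simp flip: ennreal_plus)
  finally have "prob_space (mixture \<tau> F H)"
    by (intro prob_spaceI) simp
  then show ?thesis
    using sets by (simp add: space_prob_algebra)
qed

definition psi_bar :: "'w measure \<Rightarrow> ('w \<Rightarrow> 'g \<Rightarrow> 'p \<Rightarrow> real ^ 'n) \<Rightarrow>
    ('w \<Rightarrow> 'g \<Rightarrow> 'a \<Rightarrow> 'p \<Rightarrow> real ^ 'n) \<Rightarrow> 'g \<Rightarrow> 'a \<Rightarrow> 'p \<Rightarrow> real ^ 'n" where
  "psi_bar F\<^sub>0 g \<phi> \<gamma> \<alpha> \<theta> = (\<integral>w. g w \<gamma> \<theta> + \<phi> w \<gamma> \<alpha> \<theta> \<partial>F\<^sub>0)"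

text \<open>Hadamard derivative \<open>f'\<close> at \<open>x\<close> of a map \<open>f\<close> whose domain of definition is \<open>S\<close>. The limiting
  direction \<open>\<delta>\<close> ranges over the whole type, i.e. the derivative is tangential to the whole space.\<close>

definition has_hadamard_derivative ::
    "('a::real_normed_vector \<Rightarrow> 'b::real_normed_vector) \<Rightarrow> ('a \<Rightarrow> 'b) \<Rightarrow> 'a \<Rightarrow> 'a set \<Rightarrow> bool" where
  "has_hadamard_derivative f f' x S \<longleftrightarrow>
     bounded_linear f' \<and>
     (\<forall>(t :: nat \<Rightarrow> real) d \<delta>.
        filterlim t (at_right 0) sequentially \<longrightarrow> d \<longlonglongrightarrow> \<delta> \<longrightarrow>
        (\<forall>n. x + t n *\<^sub>R d n \<in> S) \<longrightarrow>
        (\<lambda>n. (f (x + t n *\<^sub>R d n) - f x) /\<^sub>R t n) \<longlonglongrightarrow> f' \<delta>)"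

definition hadamard_differentiable ::
    "('a::real_normed_vector \<Rightarrow> 'b::real_normed_vector) \<Rightarrow> 'a \<Rightarrow> 'a set \<Rightarrow> bool" where
  "hadamard_differentiable f x S \<longleftrightarrow> (\<exists>f'. has_hadamard_derivative f f' x S)"

definition twice_continuously_frechet_differentiable_on ::
    "('a::real_normed_vector \<Rightarrow> 'b::real_normed_vector) \<Rightarrow> 'a set \<Rightarrow> bool" where
  "twice_continuously_frechet_differentiable_on f U \<longleftrightarrow>
     (\<exists>(f' :: 'a \<Rightarrow> 'a \<Rightarrow>\<^sub>L 'b) (f'' :: 'a \<Rightarrow> 'a \<Rightarrow>\<^sub>L 'a \<Rightarrow>\<^sub>L 'b).
        (\<forall>x\<in>U. (f has_derivative blinfun_apply (f' x)) (at x)) \<and>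
        (\<forall>x\<in>U. (f' has_derivative blinfun_apply (f'' x)) (at x)) \<and>
        continuous_on U f'')"

end

theory Submission
  imports Defs
begin

text \<open>By the chain rule for Hadamard derivatives, the right derivative at \<open>0\<close> of
  \<open>\<tau> \<mapsto> \<psi>(\<gamma>(F\<^sub>\<tau>))\<close> is \<open>D\<psi>\<close> applied to the right derivative of \<open>\<tau> \<mapsto> \<gamma>(F\<^sub>\<tau>)\<close>. So the bounded
  linear map \<open>D\<psi>\<close> vanishes on a dense set, hence everywhere. Under Frechet differentiability the
  first derivative thus vanishes at \<open>\<gamma>\<^sub>0\<close>, so near \<open>\<gamma>\<^sub>0\<close> it is \<open>O(\<parallel>\<gamma> - \<gamma>\<^sub>0\<parallel>)\<close>, and the mean value
  inequality on the ball of radius \<open>\<parallel>\<gamma> - \<gamma>\<^sub>0\<parallel>\<close> gives the quadratic bound.\<close>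

text \<open>To the right of 0 the absolute value of \<tau> is \<tau> itself, so the normalised
  remainder is the difference quotient minus v.\<close>

lemma has_vector_derivative_at_right_0_iff:
  "(c has_vector_derivative v) (at_right 0) \<longleftrightarrow>
    ((\<lambda>\<tau>. (c \<tau> - c 0) /\<^sub>R \<tau>) \<longlongrightarrow> v) (at_right (0::real))"
proof -
  have "(c has_vector_derivative v) (at_right 0) \<longleftrightarrow>
      ((\<lambda>\<tau>. (c \<tau> - c 0 - \<tau> *\<^sub>R v) /\<^sub>R \<bar>\<tau>\<bar>) \<longlongrightarrow> 0) (at_right 0)"
    by (simp add: has_vector_derivative_def has_derivative_within bounded_linear_scaleR_left
        diff_diff_eq divide_inverse scaleR_conv_of_real)
  also have "\<dots> \<longleftrightarrow> ((\<lambda>\<tau>. (c \<tau> - c 0) /\<^sub>R \<tau> - v) \<longlongrightarrow> 0) (at_right 0)"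
    by (intro filterlim_cong refl eventually_at_rightI[of 0 1]) (auto simp: scaleR_diff_right)
  finally show ?thesis
    by (simp add: LIM_zero_iff)
qed

text \<open>Hadamard derivatives are stated with sequences, so right derivatives are brought to the
  same form. The filter only sees points near 0, hence the sequences can be kept in (0,1], the range
  of mixture weights.\<close>

lemma has_vector_derivative_at_right_0_sequentially:
  "(c has_vector_derivative v) (at_right 0) \<longleftrightarrow>
    (\<forall>t. (\<forall>n. t n \<in> {0<..1}) \<longrightarrow> t \<longlonglongrightarrow> (0::real) \<longrightarrow> (\<lambda>n. (c (t n) - c 0) /\<^sub>R t n) \<longlonglongrightarrow> v)"
proof -
  have "at_right 0 = at (0::real) within {0<..1}"
    by (rule at_within_nhd[of _ "{..<1}"]) auto
  then show ?thesis
    unfolding has_vector_derivative_at_right_0_iff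
    by (simp add: tendsto_at_iff_sequentially comp_def)
qed

lemma has_hadamard_derivative_imp_right_derivative:
  assumes "has_hadamard_derivative c c' 0 {0..1}"
  shows "(c has_vector_derivative c' 1) (at_right 0)"
  unfolding has_vector_derivative_at_right_0_sequentially
proof (intro allI impI)
  fix t :: "nat \<Rightarrow> real"
  assume t: "\<forall>n. t n \<in> {0<..1}" "t \<longlonglongrightarrow> 0"
  then have "filterlim t (at_right 0) sequentially"
    by (auto intro!: tendsto_imp_filterlim_at_right)
  \<comment> \<open>The upper bound 1 on \<open>t n\<close> keeps the perturbed points in the domain
    \<open>{0..1}\<close>.\<close>
  moreover have "\<forall>n. 0 + t n *\<^sub>R 1 \<in> {0..1::real}"
    using t(1) by (simp add: less_imp_le)
  ultimately show "(\<lambda>n. (c (t n) - c 0) /\<^sub>R t n) \<longlonglongrightarrow> c' 1"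
    using assms[unfolded has_hadamard_derivative_def, THEN conjunct2, rule_format,
        of t "\<lambda>_. 1" 1] by simp
qed

text \<open>The difference quotients of \<open>c\<close> serve as the varying directions that the
  Hadamard property allows. Fixed directions would only cover straight paths.\<close>

lemma has_hadamard_derivative_chain_right:
  assumes f: "has_hadamard_derivative f f' (c 0) UNIV"
    and c: "(c has_vector_derivative v) (at_right 0)"
  shows "((\<lambda>\<tau>. f (c \<tau>)) has_vector_derivative f' v) (at_right 0)"
  unfolding has_vector_derivative_at_right_0_sequentially
proof (intro allI impI)
  fix t :: "nat \<Rightarrow> real"
  assume t: "\<forall>n. t n \<in> {0<..1}" "t \<longlonglongrightarrow> 0"
  define d where "d n = (c (t n) - c 0) /\<^sub>R t n" for n
  have "d \<longlonglongrightarrow> v"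
    using c t unfolding has_vector_derivative_at_right_0_sequentially d_def by blast
  moreover have "filterlim t (at_right 0) sequentially"
    using t by (auto intro!: tendsto_imp_filterlim_at_right)
  ultimately have "(\<lambda>n. (f (c 0 + t n *\<^sub>R d n) - f (c 0)) /\<^sub>R t n) \<longlonglongrightarrow> f' v"
    using f unfolding has_hadamard_derivative_def by blast
  moreover have "c 0 + t n *\<^sub>R d n = c (t n)" for n
    using t(1)[rule_format, of n] by (simp add: d_def)
  ultimately show "(\<lambda>n. (f (c (t n)) - f (c 0)) /\<^sub>R t n) \<longlonglongrightarrow> f' v"
    by simp
qed

text \<open>Both maps give the right derivative of \<open>f\<close> along each ray from
  \<open>x\<close>, and that derivative is unique. This carries the vanishing of a Hadamard
  derivative over to the Frechet derivative.\<close>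

lemma has_hadamard_derivative_unique_frechet:
  assumes "has_hadamard_derivative f f' x UNIV" "(f has_derivative D) (at x)"
  shows "f' = D"
proof
  fix \<delta>
  let ?c = "\<lambda>\<tau>::real. x + \<tau> *\<^sub>R \<delta>"
  have c: "(?c has_vector_derivative \<delta>) (at_right 0)"
    by (auto intro!: derivative_eq_intros)
  have "((\<lambda>\<tau>. f (?c \<tau>)) has_vector_derivative f' \<delta>) (at_right 0)"
    using has_hadamard_derivative_chain_right[of f f' ?c, OF _ c] assms(1) by simp
  moreover have "((f \<circ> ?c) has_vector_derivative D \<delta>) (at_right 0)"
    using assms(2) by (intro vector_derivative_diff_chain_within[OF c])
      (simp add: has_derivative_at_withinI)
  ultimately show "f' \<delta> = D \<delta>"
    by (intro vector_derivative_unique_within[of 0 "{0<..}"]) (auto simp: comp_def)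
qed

lemma bounded_linear_eq_0_on_dense:
  assumes "bounded_linear f" "closure S = UNIV" "\<And>x. x \<in> S \<Longrightarrow> f x = 0"
  shows "f x = 0"
proof -
  have "closed {x. f x = 0}"
    using assms(1) by (intro closed_Collect_eq linear_continuous_on continuous_on_const)
  then have "closure S \<subseteq> {x. f x = 0}"
    using assms(3) by (intro closure_minimal) auto
  then show ?thesis
    using assms(2) by auto
qed

lemma quadratic_bound_of_critical_point:
  fixes f :: "'a::real_normed_vector \<Rightarrow> 'b::real_normed_vector" and f' :: "'a \<Rightarrow> 'a \<Rightarrow>\<^sub>L 'b"
  assumes U: "open U" "x\<^sub>0 \<in> U"
    and f: "\<And>x. x \<in> U \<Longrightarrow> (f has_derivative f' x) (at x)"
    and f': "(f' has_derivative L) (at x\<^sub>0)"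
    and crit: "f' x\<^sub>0 = 0"
  obtains C \<epsilon> where "C > 0" "\<epsilon> > 0"
    "\<And>x. norm (x - x\<^sub>0) < \<epsilon> \<Longrightarrow> norm (f x - f x\<^sub>0) \<le> C * (norm (x - x\<^sub>0))\<^sup>2"
proof -
  obtain K where K: "K > 0" "\<And>h. norm (L h) \<le> norm h * K"
    using bounded_linear.pos_bounded[OF has_derivative_bounded_linear[OF f']] by blast
  \<comment> \<open>The remainder of \<open>f'\<close> is taken with tolerance 1. This is the 1 in
    the constant \<open>K + 1\<close>, where \<open>K\<close> bounds \<open>L\<close>.\<close>
  obtain d where d: "d > 0"
    "\<And>y. norm (y - x\<^sub>0) < d \<Longrightarrow> norm (f' y - f' x\<^sub>0 - L (y - x\<^sub>0)) \<le> 1 * norm (y - x\<^sub>0)"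
    using f' unfolding has_derivative_at_alt by (meson zero_less_one)
  obtain e where e: "e > 0" "ball x\<^sub>0 e \<subseteq> U"
    using U by (meson openE)
  have f'_bound: "norm (f' y) \<le> (K + 1) * norm (y - x\<^sub>0)" if "norm (y - x\<^sub>0) < d" for y
  proof -
    have "norm (f' y) \<le> norm (f' y - L (y - x\<^sub>0)) + norm (L (y - x\<^sub>0))"
      using norm_triangle_sub by (simp add: add.commute)
    also have "\<dots> \<le> 1 * norm (y - x\<^sub>0) + norm (y - x\<^sub>0) * K"
      using d(2)[OF that] K(2) by (intro add_mono) (simp_all add: crit)
    finally show ?thesis
      by (simp add: algebra_simps)
  qed
  show ?thesis
  proof
    \<comment> \<open>Radius \<open>d\<close> makes the linear growth bound on \<open>f'\<close>
      valid, and \<open>e\<close> keeps the closed ball through \<open>x\<close> inside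
      \<open>U\<close>.\<close>
    show "K + 1 > 0" "min d e > 0"
      using K d e by auto
    fix x
    assume x: "norm (x - x\<^sub>0) < min d e"
    let ?r = "norm (x - x\<^sub>0)"
    have near: "norm (y - x\<^sub>0) \<le> ?r" if "y \<in> cball x\<^sub>0 ?r" for y
      using that by (simp add: dist_norm norm_minus_commute)
    \<comment> \<open>Mean value inequality on a convex set containing both points. As the ball has
      radius exactly \<open>?r\<close>, the derivative bound contributes one factor
      \<open>?r\<close> and the increment the other.\<close>
    have "norm (f x - f x\<^sub>0) \<le> (K + 1) * ?r * norm (x - x\<^sub>0)"
    proof (rule differentiable_bound[where S = "cball x\<^sub>0 ?r" and f' = "\<lambda>y. blinfun_apply (f' y)"])
      fix y
      assume y: "y \<in> cball x\<^sub>0 ?r"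
      have "y \<in> U"
        using near[OF y] x e(2) by (auto simp: subset_iff dist_norm norm_minus_commute)
      then show "(f has_derivative f' y) (at y within cball x\<^sub>0 ?r)"
        by (rule has_derivative_at_withinI[OF f])
      have "norm (f' y) \<le> (K + 1) * norm (y - x\<^sub>0)"
        using near[OF y] x by (intro f'_bound) simp
      also have "\<dots> \<le> (K + 1) * ?r"
        using near[OF y] K(1) by (intro mult_left_mono) auto
      finally show "onorm (f' y) \<le> (K + 1) * ?r"
        by (simp add: norm_blinfun.rep_eq)
    qed (auto simp: dist_norm norm_minus_commute)
    then show "norm (f x - f x\<^sub>0) \<le> (K + 1) * ?r\<^sup>2"
      by (simp add: power2_eq_square mult.assoc)
  qed
qed

theorem theorem3:
  fixes M :: "'w measure" and F\<^sub>0 :: "'w measure" and \<H> :: "'w measure set"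
    and g :: "'w \<Rightarrow> 'g::real_normed_vector \<Rightarrow> 'p \<Rightarrow> real ^ 'n"
    and \<phi> :: "'w \<Rightarrow> 'g \<Rightarrow> 'a \<Rightarrow> 'p \<Rightarrow> real ^ 'n"
    and \<gamma>_of :: "'w measure \<Rightarrow> 'g" and \<alpha>_of :: "'w measure \<Rightarrow> 'a"
    and \<gamma>\<^sub>0 :: 'g and \<alpha>\<^sub>0 :: 'a and \<theta>\<^sub>0 :: 'p
    and D\<psi> :: "'g \<Rightarrow> real ^ 'n"
  assumes F0: "F\<^sub>0 \<in> space (prob_algebra M)"
    and H: "\<H> \<subseteq> space (prob_algebra M)"
    and \<gamma>0: "\<gamma>\<^sub>0 = \<gamma>_of F\<^sub>0"
    and \<alpha>0: "\<alpha>\<^sub>0 = \<alpha>_of F\<^sub>0"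
    and g0: "has_bochner_integral F\<^sub>0 (\<lambda>w. g w \<gamma>\<^sub>0 \<theta>\<^sub>0) 0"
    and \<phi>0: "has_bochner_integral F\<^sub>0 (\<lambda>w. \<phi> w \<gamma>\<^sub>0 \<alpha>\<^sub>0 \<theta>\<^sub>0) 0"
    and well_defined: "\<forall>\<^sub>F \<gamma> in nhds \<gamma>\<^sub>0. integrable F\<^sub>0 (\<lambda>w. g w \<gamma> \<theta>\<^sub>0 + \<phi> w \<gamma> \<alpha>\<^sub>0 \<theta>\<^sub>0)"
    and i_\<alpha>: "\<And>H. H \<in> \<H> \<Longrightarrow> \<exists>\<epsilon>>0. \<forall>\<tau>\<in>{0..<\<epsilon>}. \<alpha>_of (mixture \<tau> F\<^sub>0 H) = \<alpha>\<^sub>0"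
    and i_deriv: "\<And>H. H \<in> \<H> \<Longrightarrow>
      ((\<lambda>\<tau>. psi_bar F\<^sub>0 g \<phi> (\<gamma>_of (mixture \<tau> F\<^sub>0 H)) (\<alpha>_of (mixture \<tau> F\<^sub>0 H)) \<theta>\<^sub>0)
        has_vector_derivative 0) (at_right 0)"
    and ii: "has_hadamard_derivative (\<lambda>\<gamma>. psi_bar F\<^sub>0 g \<phi> \<gamma> \<alpha>\<^sub>0 \<theta>\<^sub>0) D\<psi> \<gamma>\<^sub>0 UNIV"
    and iii: "\<And>H. H \<in> \<H> \<Longrightarrow>
      hadamard_differentiable (\<lambda>\<tau>. \<gamma>_of (mixture \<tau> F\<^sub>0 H)) 0 {0..1}"
    and iv: "closure {vector_derivative (\<lambda>\<tau>. \<gamma>_of (mixture \<tau> F\<^sub>0 H)) (at_right 0) | H. H \<in> \<H>} = UNIV"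
  shows "(\<forall>\<delta>. D\<psi> \<delta> = 0) \<and>
    ((\<exists>U. open U \<and> \<gamma>\<^sub>0 \<in> U \<and>
        twice_continuously_frechet_differentiable_on (\<lambda>\<gamma>. psi_bar F\<^sub>0 g \<phi> \<gamma> \<alpha>\<^sub>0 \<theta>\<^sub>0) U) \<longrightarrow>
     (\<exists>C>0. \<exists>\<epsilon>>0. \<forall>\<gamma>. norm (\<gamma> - \<gamma>\<^sub>0) < \<epsilon> \<longrightarrow>
        norm (psi_bar F\<^sub>0 g \<phi> \<gamma> \<alpha>\<^sub>0 \<theta>\<^sub>0) \<le> C * (norm (\<gamma> - \<gamma>\<^sub>0))\<^sup>2))"
proof -
  let ?\<psi> = "\<lambda>\<gamma>. psi_bar F\<^sub>0 g \<phi> \<gamma> \<alpha>\<^sub>0 \<theta>\<^sub>0"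
  have D_zero_path: "D\<psi> (vector_derivative (\<lambda>\<tau>. \<gamma>_of (mixture \<tau> F\<^sub>0 K)) (at_right 0)) = 0"
    if K: "K \<in> \<H>" for K
  proof -
    let ?c = "\<lambda>\<tau>. \<gamma>_of (mixture \<tau> F\<^sub>0 K)"
    let ?\<alpha> = "\<lambda>\<tau>. \<alpha>_of (mixture \<tau> F\<^sub>0 K)"
    have "sets K = sets F\<^sub>0"
      using F0 H K by (auto simp: space_prob_algebra)
    \<comment> \<open>Weight 0 returns \<open>F\<^sub>0\<close> because both measures share a
      sigma-algebra, so the path starts at the point where \<open>D\<psi>\<close> is the
      derivative.\<close>
    then have c0: "?c 0 = \<gamma>\<^sub>0" and \<alpha>_0: "?\<alpha> 0 = \<alpha>\<^sub>0"
      by (simp_all add: mixture_0 \<gamma>0 \<alpha>0)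
    \<comment> \<open>\<open>vector_derivative\<close> is a choice operator; Hadamard
      differentiability of the path makes its value a genuine right derivative.\<close>
    have c: "(?c has_vector_derivative vector_derivative ?c (at_right 0)) (at_right 0)"
      using iii[OF K] has_hadamard_derivative_imp_right_derivative
      unfolding hadamard_differentiable_def by (metis differentiableI_vector vector_derivative_works)
    have "((\<lambda>\<tau>. ?\<psi> (?c \<tau>)) has_vector_derivative
        D\<psi> (vector_derivative ?c (at_right 0))) (at_right 0)"
      using has_hadamard_derivative_chain_right[of ?\<psi> D\<psi> ?c, OF _ c] ii by (simp only: c0)
    \<comment> \<open>The hypothesis differentiates along the moving \<open>?\<alpha>\<close>. Since
      \<open>?\<alpha>\<close> stays at \<open>\<alpha>\<^sub>0\<close> for small weights, including
      0, the difference quotients agree with those for fixed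
      \<open>\<alpha>\<^sub>0\<close>.\<close>
    moreover have "((\<lambda>\<tau>. ?\<psi> (?c \<tau>)) has_vector_derivative 0) (at_right 0)"
    proof -
      obtain \<epsilon> where \<epsilon>: "\<epsilon> > 0" "\<forall>\<tau>\<in>{0..<\<epsilon>}. ?\<alpha> \<tau> = \<alpha>\<^sub>0"
        using i_\<alpha>[OF K] by blast
      have "((\<lambda>\<tau>. (psi_bar F\<^sub>0 g \<phi> (?c \<tau>) (?\<alpha> \<tau>) \<theta>\<^sub>0 - ?\<psi> (?c 0)) /\<^sub>R \<tau>) \<longlongrightarrow> 0) (at_right 0)"
        using i_deriv[OF K] unfolding has_vector_derivative_at_right_0_iff \<alpha>_0 .
      moreover have "\<forall>\<^sub>F \<tau> in at_right 0. (psi_bar F\<^sub>0 g \<phi> (?c \<tau>) (?\<alpha> \<tau>) \<theta>\<^sub>0 - ?\<psi> (?c 0)) /\<^sub>R \<tau>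
          = (?\<psi> (?c \<tau>) - ?\<psi> (?c 0)) /\<^sub>R \<tau>"
        using \<epsilon> by (intro eventually_at_rightI[of 0 \<epsilon>]) auto
      ultimately show ?thesis
        unfolding has_vector_derivative_at_right_0_iff by (rule Lim_transform_eventually)
    qed
    ultimately show ?thesis
      by (intro vector_derivative_unique_within[of 0 "{0<..}"]) auto
  qed
  have D_zero: "D\<psi> \<delta> = 0" for \<delta>
  proof (rule bounded_linear_eq_0_on_dense[OF _ iv])
    show "bounded_linear D\<psi>"
      using ii by (simp add: has_hadamard_derivative_def)
  qed (auto simp: D_zero_path)
  \<comment> \<open>The two moment conditions add up to this; it turns the later bound on an
    increment of \<open>?\<psi>\<close> into a bound on \<open>?\<psi>\<close> itself.\<close>
  have \<psi>_0: "?\<psi> \<gamma>\<^sub>0 = 0"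
    using has_bochner_integral_add[OF g0 \<phi>0]
    by (simp add: psi_bar_def has_bochner_integral_integral_eq)
  have "\<exists>C>0. \<exists>\<epsilon>>0. \<forall>\<gamma>. norm (\<gamma> - \<gamma>\<^sub>0) < \<epsilon> \<longrightarrow> norm (?\<psi> \<gamma>) \<le> C * (norm (\<gamma> - \<gamma>\<^sub>0))\<^sup>2"
    if U: "open U" "\<gamma>\<^sub>0 \<in> U" "twice_continuously_frechet_differentiable_on ?\<psi> U" for U
  proof -
    obtain f' :: "'g \<Rightarrow> 'g \<Rightarrow>\<^sub>L (real ^ 'n)" and f'' :: "'g \<Rightarrow> 'g \<Rightarrow>\<^sub>L 'g \<Rightarrow>\<^sub>L (real ^ 'n)"
      where f': "\<And>x. x \<in> U \<Longrightarrow> (?\<psi> has_derivative f' x) (at x)"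
        and f'': "\<And>x. x \<in> U \<Longrightarrow> (f' has_derivative f'' x) (at x)"
      using U(3) unfolding twice_continuously_frechet_differentiable_on_def by blast
    have "D\<psi> = f' \<gamma>\<^sub>0"
      using ii f'[OF U(2)] by (rule has_hadamard_derivative_unique_frechet)
    then have "f' \<gamma>\<^sub>0 = 0"
      using D_zero by (intro blinfun_eqI) (metis zero_blinfun.rep_eq)
    then obtain C \<epsilon> where "C > 0" "\<epsilon> > 0"
      "\<And>\<gamma>. norm (\<gamma> - \<gamma>\<^sub>0) < \<epsilon> \<Longrightarrow> norm (?\<psi> \<gamma> - ?\<psi> \<gamma>\<^sub>0) \<le> C * (norm (\<gamma> - \<gamma>\<^sub>0))\<^sup>2"
      using quadratic_bound_of_critical_point[OF U(1,2) f' f''[OF U(2)]] by metis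
    then show ?thesis
      unfolding \<psi>_0 by auto
  qed
  with D_zero show ?thesis
    by blast
qed

end
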